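(* Let $A$ be a non-empty set of atoms. The six axioms of $\mathrm{EqSSCL}$, namely (Neg) $\mathsf F=\neg\mathsf T$, (Or) $x\lor_s y=\neg(\neg x\land_s\neg y)$, (Tand) $\mathsf T\land_s x=x$, (Abs) $x\land_s(x\lor_s y)=x$, (Mem) $(x\lor_s y)\land_s z=(\neg x\land_s(y\land_s z))\lor_s(x\land_s z)$, (Comm) $x\land_s y=y\land_s x$, are independent: none of them is derivable in equational logic from the other five.
   Context: Terms are over $\Sigma_{SCL}(A)=\{\land_s,\lor_s,\neg,\mathsf T,\mathsf F\}\cup A$ (atoms and $\mathsf T,\mathsf F$ constants, $\neg$ unary, $\land_s,\lor_s$ binary sequential conjunction/disjunction) with variables. *)

theory Defs
  imports Main
begin

(* Open terms over the signature {and, or, neg, T, F} \<union> A. The set A of atoms is the type 'a,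
   which is non-empty as every HOL type is; atoms are constants of the signature, hence not
   affected by substitution. The variables are indexed by nat. *)
datatype 'a sterm =
    Var nat
  | Atom 'a
  | Tru  ("\<T>")
  | Fls  ("\<F>")
  | Neg "'a sterm"  ("\<not>\<^sub>s _" [75] 75)
  | Conj "'a sterm" "'a sterm"  (infixl "\<and>\<^sub>s" 70)
  | Disj "'a sterm" "'a sterm"  (infixl "\<or>\<^sub>s" 65)

primrec subst :: "(nat \<Rightarrow> 'a sterm) \<Rightarrow> 'a sterm \<Rightarrow> 'a sterm" where
  "subst \<sigma> (Var n) = \<sigma> n"
| "subst \<sigma> (Atom a) = Atom a"
| "subst \<sigma> \<T> = \<T>"
| "subst \<sigma> \<F> = \<F>"
| "subst \<sigma> (\<not>\<^sub>s s) = \<not>\<^sub>s (subst \<sigma> s)"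
| "subst \<sigma> (s \<and>\<^sub>s t) = subst \<sigma> s \<and>\<^sub>s subst \<sigma> t"
| "subst \<sigma> (s \<or>\<^sub>s t) = subst \<sigma> s \<or>\<^sub>s subst \<sigma> t"

type_synonym 'a equation = "'a sterm \<times> 'a sterm"

inductive eq_derivable :: "'a equation set \<Rightarrow> 'a equation \<Rightarrow> bool"  (infix "\<turnstile>" 50)
  for E :: "'a equation set" where
  axm: "e \<in> E \<Longrightarrow> E \<turnstile> e"
| refl: "E \<turnstile> (s, s)"
| sym: "E \<turnstile> (s, t) \<Longrightarrow> E \<turnstile> (t, s)"
| trans: "E \<turnstile> (s, t) \<Longrightarrow> E \<turnstile> (t, u) \<Longrightarrow> E \<turnstile> (s, u)"
| cong_Neg: "E \<turnstile> (s, t) \<Longrightarrow> E \<turnstile> (\<not>\<^sub>s s, \<not>\<^sub>s t)"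
| cong_Conj: "E \<turnstile> (s, t) \<Longrightarrow> E \<turnstile> (s', t') \<Longrightarrow> E \<turnstile> (s \<and>\<^sub>s s', t \<and>\<^sub>s t')"
| cong_Disj: "E \<turnstile> (s, t) \<Longrightarrow> E \<turnstile> (s', t') \<Longrightarrow> E \<turnstile> (s \<or>\<^sub>s s', t \<or>\<^sub>s t')"
| inst: "E \<turnstile> (s, t) \<Longrightarrow> E \<turnstile> (subst \<sigma> s, subst \<sigma> t)"

abbreviation vx :: "'a sterm" where "vx \<equiv> Var 0"
abbreviation vy :: "'a sterm" where "vy \<equiv> Var 1"
abbreviation vz :: "'a sterm" where "vz \<equiv> Var 2"

definition ax_Neg :: "'a equation" where
  "ax_Neg = (\<F>, \<not>\<^sub>s \<T>)"

definition ax_Or :: "'a equation" where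
  "ax_Or = (vx \<or>\<^sub>s vy, \<not>\<^sub>s (\<not>\<^sub>s vx \<and>\<^sub>s \<not>\<^sub>s vy))"

definition ax_Tand :: "'a equation" where
  "ax_Tand = (\<T> \<and>\<^sub>s vx, vx)"

definition ax_Abs :: "'a equation" where
  "ax_Abs = (vx \<and>\<^sub>s (vx \<or>\<^sub>s vy), vx)"

definition ax_Mem :: "'a equation" where
  "ax_Mem = ((vx \<or>\<^sub>s vy) \<and>\<^sub>s vz, (\<not>\<^sub>s vx \<and>\<^sub>s (vy \<and>\<^sub>s vz)) \<or>\<^sub>s (vx \<and>\<^sub>s vz))"

definition ax_Comm :: "'a equation" where
  "ax_Comm = (vx \<and>\<^sub>s vy, vy \<and>\<^sub>s vx)"

definition EqSSCL :: "'a equation set" where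
  "EqSSCL = {ax_Neg, ax_Or, ax_Tand, ax_Abs, ax_Mem, ax_Comm}"

end

theory Submission
  imports Defs
begin

text \<open>For each axiom there is an algebra on at most three elements that refutes it and satisfies
  the other five. For all axioms but commutativity, two elements suffice: the Boolean conjunction
  is kept and only the remaining operations and constants are changed. For commutativity, a third,
  left-absorbing truth value (\<open>None\<close>) is added to the short-circuit connectives.\<close>

text \<open>Axioms contain no atoms, so the interpretation of the atoms is irrelevant; they are all
  mapped to the value of \<open>\<T>\<close>.\<close>
primrec sem :: "'b \<Rightarrow> 'b \<Rightarrow> ('b \<Rightarrow> 'b) \<Rightarrow> ('b \<Rightarrow> 'b \<Rightarrow> 'b) \<Rightarrow> ('b \<Rightarrow> 'b \<Rightarrow> 'b) \<Rightarrow>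
    (nat \<Rightarrow> 'b) \<Rightarrow> 'a sterm \<Rightarrow> 'b" where
  "sem t f n c d v (Var k) = v k"
| "sem t f n c d v (Atom a) = t"
| "sem t f n c d v \<T> = t"
| "sem t f n c d v \<F> = f"
| "sem t f n c d v (\<not>\<^sub>s p) = n (sem t f n c d v p)"
| "sem t f n c d v (p \<and>\<^sub>s q) = c (sem t f n c d v p) (sem t f n c d v q)"
| "sem t f n c d v (p \<or>\<^sub>s q) = d (sem t f n c d v p) (sem t f n c d v q)"

definition valid :: "'b \<Rightarrow> 'b \<Rightarrow> ('b \<Rightarrow> 'b) \<Rightarrow> ('b \<Rightarrow> 'b \<Rightarrow> 'b) \<Rightarrow> ('b \<Rightarrow> 'b \<Rightarrow> 'b) \<Rightarrow>
    'a equation \<Rightarrow> bool" where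
  "valid t f n c d e \<longleftrightarrow> (\<forall>v. sem t f n c d v (fst e) = sem t f n c d v (snd e))"

text \<open>Gives the \<open>inst\<close> case of \<open>soundness\<close>.\<close>

lemma sem_subst:
  "sem t f n c d v (subst \<sigma> p) = sem t f n c d (\<lambda>k. sem t f n c d v (\<sigma> k)) p"
  by (induction p) auto

lemma soundness:
  assumes "E \<turnstile> e" "\<forall>e\<in>E. valid t f n c d e"
  shows "valid t f n c d e"
  using assms(1)
proof induction
  case (axm e)
  then show ?case using assms(2) by blast
qed (simp_all add: valid_def sem_subst)

lemma not_derivable:
  assumes "\<forall>e'\<in>E - {e}. valid t f n c d e'" "\<not> valid t f n c d e"
  shows "\<not> (E - {e} \<turnstile> e)"
proof
  assume "E - {e} \<turnstile> e"
  from soundness[OF this assms(1)] assms(2) show False by contradiction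
qed

text \<open>The axioms contain only the variables 0, 1, 2, so their validity becomes a statement
  about elements of the algebra.\<close>

lemma all_valuations_iff:
  "(\<forall>v :: nat \<Rightarrow> 'b. P (v 0) (v 1) (v 2)) \<longleftrightarrow> (\<forall>x y z. P x y z)"
proof
  assume *: "\<forall>v :: nat \<Rightarrow> 'b. P (v 0) (v 1) (v 2)"
  show "\<forall>x y z. P x y z"
  proof (intro allI)
    fix x y z
    show "P x y z"
      \<comment> \<open>The default value \<open>z\<close> is what this valuation takes at
        2.\<close>
      using *[rule_format, of "(\<lambda>_. z)(0 := x, 1 := y)"] by simp
  qed
qed blast

lemma valid_ax_Neg: "valid t f n c d ax_Neg \<longleftrightarrow> f = n t"
  by (simp add: valid_def ax_Neg_def)

lemma valid_ax_Or: "valid t f n c d ax_Or \<longleftrightarrow> (\<forall>x y. d x y = n (c (n x) (n y)))"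
  using all_valuations_iff[of "\<lambda>x y z. d x y = n (c (n x) (n y))"]
  by (simp add: valid_def ax_Or_def)

lemma valid_ax_Tand: "valid t f n c d ax_Tand \<longleftrightarrow> (\<forall>x. c t x = x)"
  using all_valuations_iff[of "\<lambda>x y z. c t x = x"]
  by (simp add: valid_def ax_Tand_def)

lemma valid_ax_Abs: "valid t f n c d ax_Abs \<longleftrightarrow> (\<forall>x y. c x (d x y) = x)"
  using all_valuations_iff[of "\<lambda>x y z. c x (d x y) = x"]
  by (simp add: valid_def ax_Abs_def)

lemma valid_ax_Mem:
  "valid t f n c d ax_Mem \<longleftrightarrow> (\<forall>x y z. c (d x y) z = d (c (n x) (c y z)) (c x z))"
  using all_valuations_iff[of "\<lambda>x y z. c (d x y) z = d (c (n x) (c y z)) (c x z)"]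
  by (simp add: valid_def ax_Mem_def)

lemma valid_ax_Comm: "valid t f n c d ax_Comm \<longleftrightarrow> (\<forall>x y. c x y = c y x)"
  using all_valuations_iff[of "\<lambda>x y z. c x y = c y x"]
  by (simp add: valid_def ax_Comm_def)

lemmas valid_ax =
  valid_ax_Neg valid_ax_Or valid_ax_Tand valid_ax_Abs valid_ax_Mem valid_ax_Comm

text \<open>Only \<open>ax_Neg\<close> mentions \<open>\<F>\<close>, so giving it the value
  \<open>True\<close> breaks this axiom alone.\<close>

lemma independent_Neg: "\<not> (EqSSCL - {ax_Neg} \<turnstile> ax_Neg)"
  by (rule not_derivable[where t = True and f = True and n = Not and c = "(\<and>)" and d = "(\<or>)"])
    (auto simp: EqSSCL_def valid_ax)

text \<open>With negation constantly \<open>True\<close>, \<open>ax_Mem\<close> becomes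
  distributivity, while \<open>ax_Or\<close> fails at \<open>x = y = False\<close>.\<close>

lemma independent_Or: "\<not> (EqSSCL - {ax_Or} \<turnstile> ax_Or)"
  by (rule not_derivable[where t = True and f = True and n = "\<lambda>_. True" and c = "(\<and>)" and d = "(\<or>)"])
    (auto simp: EqSSCL_def valid_ax)

text \<open>Swapping the constants respects \<open>ax_Neg\<close>, but \<open>c t x\<close> becomes
  constantly \<open>False\<close>.\<close>

lemma independent_Tand: "\<not> (EqSSCL - {ax_Tand} \<turnstile> ax_Tand)"
  by (rule not_derivable[where t = False and f = True and n = Not and c = "(\<and>)" and d = "(\<or>)"])
    (auto simp: EqSSCL_def valid_ax)

text \<open>With negation the identity, \<open>ax_Or\<close> forces \<open>d = c\<close>. Absorption
  then fails at \<open>x = True\<close>, \<open>y = False\<close>.\<close>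

lemma independent_Abs: "\<not> (EqSSCL - {ax_Abs} \<turnstile> ax_Abs)"
  by (rule not_derivable[where t = True and f = True and n = "\<lambda>x. x" and c = "(\<and>)" and d = "(\<and>)"])
    (auto simp: EqSSCL_def valid_ax)

text \<open>Here \<open>ax_Abs\<close> reads \<open>(x \<and> True) = x\<close>, while
  \<open>ax_Mem\<close> reads \<open>z = True\<close>.\<close>

lemma independent_Mem: "\<not> (EqSSCL - {ax_Mem} \<turnstile> ax_Mem)"
  by (rule not_derivable[where t = True and f = True and n = "\<lambda>_. True" and c = "(\<and>)"
        and d = "\<lambda>_ _. True"])
    (auto simp: EqSSCL_def valid_ax)

fun sc_and :: "bool option \<Rightarrow> bool option \<Rightarrow> bool option" where
  "sc_and (Some True) y = y"
| "sc_and x y = x"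

fun sc_or :: "bool option \<Rightarrow> bool option \<Rightarrow> bool option" where
  "sc_or (Some False) y = y"
| "sc_or x y = x"

lemma all_bool_option_iff:
  "(\<forall>x :: bool option. P x) \<longleftrightarrow> P None \<and> P (Some True) \<and> P (Some False)"
  by (metis (full_types) not_None_eq)

text \<open>Both \<open>None\<close> and \<open>Some False\<close> are left-absorbing for
  \<open>sc_and\<close>, so the two orders of this pair give different values.\<close>

lemma independent_Comm: "\<not> (EqSSCL - {ax_Comm} \<turnstile> ax_Comm)"
  by (rule not_derivable[where t = "Some True" and f = "Some False" and n = "map_option Not"
        and c = sc_and and d = sc_or])
    (auto simp: EqSSCL_def valid_ax all_bool_option_iff)

theorem theorem6p3:
  shows "\<forall>e \<in> (EqSSCL :: 'a equation set). \<not> (EqSSCL - {e} \<turnstile> e)"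
proof
  fix e :: "'a equation"
  assume "e \<in> EqSSCL"
  then have "e = ax_Neg \<or> e = ax_Or \<or> e = ax_Tand \<or> e = ax_Abs \<or> e = ax_Mem \<or> e = ax_Comm"
    by (simp add: EqSSCL_def)
  then show "\<not> (EqSSCL - {e} \<turnstile> e)"
    by (elim disjE) (simp_all only: independent_Neg independent_Or independent_Tand
        independent_Abs independent_Mem independent_Comm not_False_eq_True)
qed

end
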